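(* Let $x$ be an indeterminate. Then, for all integers $n\geq1$, $$\det_{0\leq i,j\le n-1}\left(4^i \binom{x+i+2j+1}{2j+1} + \binom{x-i+2j+1}{2j+1}\right) =2\prod_{i=1}^n \frac{2^{2i-1} \, 3^{i-1} \, \Gamma(i) \, \Gamma\bigl(\frac{3i+x}{2}\bigr)}{\Gamma(2i) \, \Gamma\bigl(\frac{i+x}{2}\bigr)}=2^{\binom {n+1}2+1}3^{\binom n2}\prod _{i=1} ^{n}\frac {i!} {(2i)!}\prod _{i=0} ^{n-1}(x+3i+1)_{n-i}.$$
   Context: The binomial coefficient is $\binom{\alpha}{p}=\frac{\alpha(\alpha-1)\cdots(\alpha-p+1)}{p!}$ if $p\ge 0$ is an integer, and $0$ if $p<0$. The Pochhammer symbol is $(\alpha)_p=\alpha(\alpha+1)\cdots(\alpha+p-1)$ for $p\ge1$ and $(\alpha)_0=1$. The quotients of Gamma functions are understood as the rational functions of $x$ obtained by simplifying using $\Gamma(z+1)=z\Gamma(z)$. *)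

theory Defs
  imports
    "Jordan_Normal_Form.Determinant"
    "HOL-Computational_Algebra.Polynomial_Factorial"
    "HOL-Library.Nonpos_Ints"
begin

instance fract :: ("{idom, ring_char_0}") field_char_0
proof
  have of_nat_Fract: "(of_nat n :: 'a fract) = Fract (of_nat n) 1" for n
    by (induction n) (simp_all add: Zero_fract_def One_fract_def)
  show "inj (of_nat :: nat \<Rightarrow> 'a fract)"
    by (rule injI) (simp add: of_nat_Fract eq_fract)
qed

text \<open>
  \<open>Gamma_quot a b\<close> stands for the quotient \<open>\<Gamma>(a) / \<Gamma>(b)\<close> for arguments that differ by an
  integer, simplified by repeated use of \<open>\<Gamma>(z + 1) = z \<Gamma>(z)\<close>; it then makes sense in any field of
  characteristic zero, in particular for \<open>a\<close> and \<open>b\<close> in a field of rational functions. The lemma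
  \<open>Gamma_quot_eq\<close> below shows that this is the only possible value.
\<close>

definition Gamma_quot :: "'a :: field_char_0 \<Rightarrow> 'a \<Rightarrow> 'a" where
  "Gamma_quot a b =
     (if \<exists>k. a = b + of_nat k then pochhammer b (THE k. a = b + of_nat k)
      else if \<exists>k. b = a + of_nat k then 1 / pochhammer a (THE k. b = a + of_nat k)
      else undefined)"

lemma Gamma_quot_add: "Gamma_quot (b + of_nat k) b = pochhammer b k"
  by (simp add: Gamma_quot_def)

lemma Gamma_quot_add': "Gamma_quot a (a + of_nat k) = 1 / pochhammer a k"
proof (cases "k = 0")
  case True
  then show ?thesis using Gamma_quot_add[of a 0] by simp
next
  case False
  have "a \<noteq> (a + of_nat k) + of_nat m" for m
  proof
    assume "a = (a + of_nat k) + of_nat m"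
    then have "of_nat (k + m) = (0 :: 'a)" by (simp add: add.assoc)
    then show False using False by (simp only: of_nat_eq_0_iff)
  qed
  then show ?thesis by (simp add: Gamma_quot_def)
qed

lemma Gamma_quot_eq:
  fixes G :: "'a :: field_char_0 \<Rightarrow> 'a"
  assumes rec: "\<And>z. z \<notin> \<int>\<^sub>\<le>\<^sub>0 \<Longrightarrow> G (z + 1) = z * G z"
    and nz: "\<And>z. z \<notin> \<int>\<^sub>\<le>\<^sub>0 \<Longrightarrow> G z \<noteq> 0"
    and ab: "a \<notin> \<int>\<^sub>\<le>\<^sub>0" "b \<notin> \<int>\<^sub>\<le>\<^sub>0" "a - b \<in> \<int>"
  shows "Gamma_quot a b = G a / G b"
proof -
  have shift: "G (z + of_nat k) = pochhammer z k * G z \<and> z + of_nat k \<notin> \<int>\<^sub>\<le>\<^sub>0"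
    if z: "z \<notin> \<int>\<^sub>\<le>\<^sub>0" for z k
  proof (induction k)
    case (Suc k)
    have "z + of_nat (Suc k) \<notin> \<int>\<^sub>\<le>\<^sub>0"
    proof
      assume "z + of_nat (Suc k) \<in> \<int>\<^sub>\<le>\<^sub>0"
      then obtain m where m: "m \<le> 0" "z + of_nat (Suc k) = of_int m"
        by (auto simp: nonpos_Ints_def)
      then have "z = of_int (m - int (Suc k))" by (simp add: algebra_simps)
      moreover have "m - int (Suc k) \<le> 0" using m(1) by simp
      ultimately show False using z nonpos_Ints_of_int by metis
    qed
    moreover have "G (z + of_nat (Suc k)) = pochhammer z (Suc k) * G z"
      using rec[of "z + of_nat k"] Suc by (simp add: pochhammer_Suc algebra_simps)
    ultimately show ?case by simp
  qed (use z in auto)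
  obtain m where m: "a - b = of_int m" using ab(3) by (auto elim: Ints_cases)
  show ?thesis
  proof (cases "m \<ge> 0")
    case True
    then have "a = b + of_nat (nat m)" using m by (simp add: algebra_simps)
    then show ?thesis using shift[OF ab(2)] nz[OF ab(2)] Gamma_quot_add by (metis nonzero_mult_div_cancel_right)
  next
    case False
    then have b: "b = a + of_nat (nat (- m))" using m by (simp add: algebra_simps)
    have "G b = pochhammer a (nat (- m)) * G a" using shift[OF ab(1)] b by metis
    then have "G a / G b = 1 / pochhammer a (nat (- m))" using nz[OF ab(1)] by simp
    then show ?thesis using Gamma_quot_add' b by metis
  qed
qed

end

theory Submission
  imports
    Defs
    "Jordan_Normal_Form.Char_Poly"
    "HOL-Computational_Algebra.Formal_Power_Series"
begin

text \<open>
  Row \<open>i\<close> lists the coefficients of \<open>t, t\<^sup>3, t\<^sup>5, \<dots>\<close> in \<open>(1 - t) ^ (- x - 1) (\<beta> ^ i + \<alpha> ^ i)\<close> with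
  \<open>\<alpha> = 1 - t\<close> and \<open>\<beta> = 4 / (1 - t)\<close>. As \<open>\<alpha> \<beta> = 4\<close>, the second factor is a polynomial of degree \<open>i\<close>
  in \<open>u = \<alpha> + \<beta>\<close>, monic for \<open>i > 0\<close>, and row operations replace it by any other monic polynomial of
  degree \<open>i\<close> in \<open>u\<close>.

  Since \<open>u - 4 = (1 + t)\<^sup>2 / (1 - t)\<close> and \<open>u - 2 = (3 + t\<^sup>2) / (1 - t)\<close>, the choice
  \<open>(u - 4) ^ m (u - 2) ^ d\<close> turns row \<open>m + d\<close>, at \<open>x = - (1 + 3 m + d)\<close>, into the odd coefficients of
  an even series. Choosing, for a given \<open>c\<close>, all such pairs with \<open>3 m + d = c\<close> shows that \<open>x + 1 + c\<close>
  divides the determinant with the full multiplicity of the product formula.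

  Since \<open>u - 5 = t (3 + t) / (1 - t)\<close>, the choice \<open>(u - 5) ^ i\<close> shows that the degree in \<open>x\<close> is at most
  \<open>n (n + 1) / 2\<close>, which is the degree of the product, and reduces the leading coefficient to a
  determinant of Vandermonde type.
\<close>

no_notation vec_index (infixl "$" 100)
unbundle fps_syntax

subsection \<open>Determinants and linear factors\<close>

text \<open>Row operations that use only the row itself and earlier ones are left multiplication by
  the lower triangular matrix \<open>?C\<close>, whose determinant is the product of its
  diagonal.\<close>

lemma det_triangular_combination:
  fixes A B c :: "nat \<Rightarrow> nat \<Rightarrow> 'a :: comm_ring_1"
  assumes "\<And>i j. i < n \<Longrightarrow> j < n \<Longrightarrow> A i j = (\<Sum>k\<le>i. c i k * B k j)"
  shows "det (mat n n (\<lambda>(i, j). A i j)) = (\<Prod>i<n. c i i) * det (mat n n (\<lambda>(i, j). B i j))"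
proof -
  let ?C = "mat n n (\<lambda>(i, k). if k \<le> i then c i k else 0)"
  have "mat n n (\<lambda>(i, j). A i j) = ?C * mat n n (\<lambda>(i, j). B i j)"
  proof (rule eq_matI)
    fix i j assume "i < dim_row (?C * mat n n (\<lambda>(i, j). B i j))"
      "j < dim_col (?C * mat n n (\<lambda>(i, j). B i j))"
    then have ij: "i < n" "j < n" by auto
    have "(\<Sum>k\<le>i. c i k * B k j) = (\<Sum>k\<in>{0..<n}. (if k \<le> i then c i k else 0) * B k j)"
      using ij by (intro sum.mono_neutral_cong_left) auto
    then show "mat n n (\<lambda>(i, j). A i j) $$ (i, j) = (?C * mat n n (\<lambda>(i, j). B i j)) $$ (i, j)"
      using ij assms[OF ij] by (auto simp: scalar_prod_def intro!: sum.cong)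
  qed auto
  moreover have "det ?C = (\<Prod>i<n. c i i)"
    by (subst det_lower_triangular[of n])
      (auto simp: prod_list_diag_prod atLeast0LessThan intro!: prod.cong)
  ultimately show ?thesis using det_mult[of ?C n "mat n n (\<lambda>(i, j). B i j)"] by simp
qed

text \<open>Every Leibniz term takes one entry from each row, hence one factor \<open>g\<close> from
  each row in \<open>S\<close>.\<close>

lemma power_card_dvd_det:
  fixes A :: "nat \<Rightarrow> nat \<Rightarrow> 'a :: comm_ring_1"
  assumes "S \<subseteq> {..<n}" "\<And>i j. i \<in> S \<Longrightarrow> j < n \<Longrightarrow> g dvd A i j"
  shows "g ^ card S dvd det (mat n n (\<lambda>(i, j). A i j))"
proof -
  have "g ^ card S dvd (\<Prod>i = 0..<n. mat n n (\<lambda>(i, j). A i j) $$ (i, p i))"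
    if "p permutes {0..<n}" for p
  proof -
    have "g ^ card S = (\<Prod>i\<in>{0..<n}. if i \<in> S then g else 1)"
      using assms(1) by (subst prod.inter_restrict[symmetric])
        (auto simp: atLeast0LessThan Int_absorb1)
    also have "\<dots> dvd (\<Prod>i = 0..<n. mat n n (\<lambda>(i, j). A i j) $$ (i, p i))"
      using assms(2) permutes_in_image[OF that] by (intro prod_dvd_prod) auto
    finally show ?thesis .
  qed
  then show ?thesis
    by (subst det_def'[of _ n]) (auto intro!: dvd_sum dvd_mult)
qed

text \<open>The \<open>d i\<close> are only bounds: if some factor has smaller degree, both sides of
  the coefficient formula are 0.\<close>

lemma prod_degree_le_coeff:
  fixes f :: "'i \<Rightarrow> 'a :: comm_ring_1 poly"
  assumes "finite I" "\<And>i. i \<in> I \<Longrightarrow> degree (f i) \<le> d i"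
  shows "degree (prod f I) \<le> sum d I \<and> coeff (prod f I) (sum d I) = (\<Prod>i\<in>I. coeff (f i) (d i))"
  using assms
proof (induction I rule: finite_induct)
  case (insert i I)
  then have IH: "degree (prod f I) \<le> sum d I" "degree (f i) \<le> d i"
    "coeff (prod f I) (sum d I) = (\<Prod>i\<in>I. coeff (f i) (d i))" by auto
  have "coeff (f i * prod f I) (d i + sum d I) = coeff (f i) (d i) * coeff (prod f I) (sum d I)"
  proof -
    have "coeff (f i * prod f I) (d i + sum d I)
      = (\<Sum>k\<le>d i + sum d I. coeff (f i) k * coeff (prod f I) (d i + sum d I - k))"
      by (simp add: coeff_mult)
    also have "\<dots> = (\<Sum>k\<in>{d i}. coeff (f i) k * coeff (prod f I) (d i + sum d I - k))"
    proof (rule sum.mono_neutral_right)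
      show "\<forall>k\<in>{..d i + sum d I} - {d i}. coeff (f i) k * coeff (prod f I) (d i + sum d I - k) = 0"
      proof
        fix k assume "k \<in> {..d i + sum d I} - {d i}"
        then consider "k > d i" | "d i + sum d I - k > sum d I" by fastforce
        then show "coeff (f i) k * coeff (prod f I) (d i + sum d I - k) = 0"
          by cases (use IH in \<open>simp_all add: coeff_eq_0\<close>)
      qed
    qed auto
    finally show ?thesis by simp
  qed
  then show ?case
    using insert.hyps IH degree_mult_le[of "f i" "prod f I"] by simp
qed auto

text \<open>Multiplying row \<open>i\<close> by \<open>X ^ i\<close> makes the degree bound depend on the column only.\<close>

lemma det_degree_le_coeff:
  fixes A :: "nat \<Rightarrow> nat \<Rightarrow> 'a :: idom poly"
  assumes deg: "\<And>i j. i < n \<Longrightarrow> j < n \<Longrightarrow> degree (monom 1 i * A i j) \<le> d j"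
  assumes N: "N + (\<Sum>i<n. i) = (\<Sum>j<n. d j)"
  shows "degree (det (mat n n (\<lambda>(i, j). A i j))) \<le> N"
    and "coeff (det (mat n n (\<lambda>(i, j). A i j))) N
      = det (mat n n (\<lambda>(i, j). coeff (monom 1 i * A i j) (d j)))"
proof -
  let ?A = "mat n n (\<lambda>(i, j). A i j)" and ?B = "mat n n (\<lambda>(i, j). monom 1 i * A i j)"
  let ?D = "\<Sum>j<n. d j"
  have m: "(\<Prod>i = 0..<n. monom (1::'a) i) = monom 1 (\<Sum>i<n. i)"
    by (induction n) (simp_all add: mult_monom one_pCons monom_0)
  have detB: "det ?B = (\<Sum>p | p permutes {0..<n}. signof p * (\<Prod>i = 0..<n. monom 1 i * A i (p i)))"
    by (subst det_def'[of _ n]) (auto intro!: sum.cong prod.cong arg_cong2[of _ _ _ _ "(*)"])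
  also have "\<dots> = (\<Sum>p | p permutes {0..<n}. signof p * (monom 1 (\<Sum>i<n. i) * (\<Prod>i = 0..<n. A i (p i))))"
    by (simp add: prod.distrib m)
  also have "\<dots> = monom 1 (\<Sum>i<n. i) * det ?A"
    by (subst det_def'[of _ n]) (auto simp: sum_distrib_left mult_ac
      intro!: sum.cong prod.cong arg_cong2[of _ _ _ _ "(*)"])
  finally have B: "det ?B = monom 1 (\<Sum>i<n. i) * det ?A" .
  have *: "degree (\<Prod>i = 0..<n. monom 1 i * A i (p i)) \<le> ?D \<and>
    coeff (\<Prod>i = 0..<n. monom 1 i * A i (p i)) ?D = (\<Prod>i = 0..<n. coeff (monom 1 i * A i (p i)) (d (p i)))"
    if p: "p permutes {0..<n}" for p
  proof -
    \<comment> \<open>Bounds that depend on the column only have the same sum for every permutation,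
      so all Leibniz terms share the bound \<open>?D\<close>.\<close>
    have "?D = (\<Sum>i = 0..<n. d (p i))"
      using sum.permute[OF p, of d] by (simp add: o_def atLeast0LessThan)
    then show ?thesis
      using prod_degree_le_coeff[of "{0..<n}" "\<lambda>i. monom 1 i * A i (p i)" "\<lambda>i. d (p i)"]
        deg permutes_in_image[OF p] by simp
  qed
  have "degree (det ?B) \<le> ?D"
    unfolding detB using * by (intro degree_sum_le) (auto simp: finite_permutations)
  then show "degree (det ?A) \<le> N"
    using N by (cases "det ?A = 0") (auto simp: B degree_mult_eq degree_monom_eq)
  have "coeff (det ?A) N = coeff (det ?B) ?D"
    by (simp add: B coeff_monom_mult flip: N)
  also have "\<dots> = (\<Sum>p | p permutes {0..<n}. signof p * (\<Prod>i = 0..<n. coeff (monom 1 i * A i (p i)) (d (p i))))"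
    unfolding detB coeff_sum
  proof (intro sum.cong refl)
    fix p assume p: "p \<in> {p. p permutes {0..<n}}"
    have "coeff (signof p * q) k = signof p * coeff q k" for q :: "'a poly" and k
      by (simp add: sign_def)
    then show "coeff (signof p * (\<Prod>i = 0..<n. monom 1 i * A i (p i))) ?D
      = signof p * (\<Prod>i = 0..<n. coeff (monom 1 i * A i (p i)) (d (p i)))"
      using * p by simp
  qed
  also have "\<dots> = det (mat n n (\<lambda>(i, j). coeff (monom 1 i * A i j) (d j)))"
    by (subst det_def'[of _ n]) (auto intro!: sum.cong prod.cong arg_cong2[of _ _ _ _ "(*)"])
  finally show "coeff (det ?A) N = det (mat n n (\<lambda>(i, j). coeff (monom 1 i * A i j) (d j)))" .
qed

text \<open>Powers of distinct linear factors are split off one at a time: the product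
  \<open>?Q\<close> of the others does not vanish at \<open>- b\<close>, so this root keeps its full
  multiplicity in the cofactor \<open>s\<close>.\<close>

lemma prod_linear_dvd:
  fixes p :: "'a :: idom poly"
  assumes "finite I" "\<And>b. [:b, 1:] ^ card {i \<in> I. f i = b} dvd p"
  shows "(\<Prod>i\<in>I. [:f i, 1:]) dvd p"
proof -
  have "(\<Prod>b\<in>B. [:b, 1:] ^ k b) dvd p" if "finite B" "\<And>b. [:b, 1:] ^ k b dvd p"
    for B and k :: "'a \<Rightarrow> nat"
    using that(1)
  proof (induction B rule: finite_induct)
    case (insert b B)
    let ?Q = "\<Prod>b\<in>B. [:b, 1:] ^ k b"
    obtain s where s: "p = ?Q * s" using insert.IH unfolding dvd_def by blast
    have Q: "poly ?Q (- b) \<noteq> 0"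
      using insert.hyps by (auto simp: poly_prod add_eq_0_iff)
    have "[:b, 1:] ^ k b dvd s"
    proof (cases "p = 0")
      case True
      then have "s = 0" using s Q by auto
      then show ?thesis by simp
    next
      case False
      then have "k b \<le> order (- b) p" using that(2)[of b] order_divides[of "- b"] by simp
      also have "\<dots> = order (- b) s"
        using False Q unfolding s by (subst order_mult) (auto simp: order_0I)
      finally show ?thesis using order_divides[of "- b" "k b" s] by simp
    qed
    then have "?Q * [:b, 1:] ^ k b dvd p" unfolding s by (rule mult_dvd_mono[OF dvd_refl])
    then show ?case using insert.hyps by (simp add: mult.commute)
  qed simp
  from this[of "f ` I" "\<lambda>b. card {i \<in> I. f i = b}"] show ?thesis
    using assms by (subst prod.group[symmetric, of I "f ` I" f]) auto
qed

text \<open>Up to row and column factors, the entries are the falling factorials of \<open>y = 2 j + 1\<close>. Replacing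
  them by the Newton polynomials with nodes \<open>1, 3, 5, \<dots>\<close> makes the matrix triangular.\<close>

lemma det_falling_factorial_odd:
  "det (mat n n (\<lambda>(i, j). if i \<le> 2 * j + 1 then 3 ^ i / fact (2 * j + 1 - i) else (0 :: 'a :: field_char_0)))
    = (\<Prod>i<n. 6 ^ i * fact i / fact (2 * i + 1))"
proof -
  let ?y = "\<lambda>j. of_nat (2 * j + 1) :: 'a"
  \<comment> \<open>The monic Newton polynomial with nodes \<open>z\<close>. The nodes 0, 1, 2, ...
    give the falling factorials, the nodes \<open>?y\<close> the triangular matrix; both families
    reduce to the same matrix \<open>B\<close> of scaled powers.\<close>
  define F where "F z i = (\<Prod>l<i. [:- z l, 1:])" for z :: "nat \<Rightarrow> 'a" and i :: nat
  define B where "B k j = ?y j ^ k / fact (2 * j + 1)" for k j :: nat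
  have F: "degree (F z i) = i \<and> coeff (F z i) i = 1" for z i
  proof (induction i)
    case (Suc i)
    then have "F z i \<noteq> 0" by auto
    moreover have "F z (Suc i) = F z i * [:- z i, 1:]" by (simp add: F_def)
    ultimately show ?case
      using Suc coeff_mult_degree_sum[of "F z i" "[:- z i, 1:]"] by (simp add: degree_mult_eq del: mult_pCons_right)
  qed (simp add: F_def)
  have expand: "a * (poly (F z i) (?y j) / fact (2 * j + 1)) = (\<Sum>k\<le>i. (a * coeff (F z i) k) * B k j)"
    for a z i j
    using F[of z i] by (simp add: poly_altdef B_def sum_divide_distrib sum_distrib_left mult_ac)
  have falling: "(\<Prod>l<i. of_nat N - of_nat l) = (if i \<le> N then fact N / fact (N - i) else (0 :: 'a))" for i N
  proof (induction i)
    case (Suc i)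
    consider "i < N" | "i = N" | "i > N" by linarith
    then show ?case
    proof cases
      case 1
      then obtain d where d: "N = i + Suc d" using less_imp_Suc_add by auto
      then have "(\<Prod>l<i. of_nat N - of_nat l) = (fact N / fact (Suc d) :: 'a)"
        using Suc by (simp del: fact_Suc)
      moreover have "of_nat N - of_nat i = (of_nat (Suc d) :: 'a)" using d by simp
      moreover have "N - Suc i = d" "Suc i \<le> N" using d by auto
      ultimately show ?thesis by (simp add: fact_Suc del: of_nat_Suc)
    next
      case 2
      then show ?thesis by simp
    next
      case 3
      then show ?thesis using Suc by simp
    qed
  qed simp
  have "det (mat n n (\<lambda>(i, j). if i \<le> 2 * j + 1 then 3 ^ i / fact (2 * j + 1 - i) else (0 :: 'a)))
    = det (mat n n (\<lambda>(i, j). 3 ^ i * (poly (F of_nat i) (?y j) / fact (2 * j + 1))))"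
  proof (intro arg_cong[of _ _ det] cong_mat refl)
    fix i j
    have "poly (F of_nat i) (?y j) = (\<Prod>l<i. ?y j - of_nat l)"
      by (simp add: F_def poly_prod)
    then show "(\<lambda>(i, j). if i \<le> 2 * j + 1 then 3 ^ i / fact (2 * j + 1 - i) else (0 :: 'a)) (i, j)
      = (\<lambda>(i, j). 3 ^ i * (poly (F of_nat i) (?y j) / fact (2 * j + 1))) (i, j)"
      by (simp add: falling del: of_nat_Suc of_nat_add of_nat_mult fact_Suc)
  qed
  also have "\<dots> = (\<Prod>i<n. 3 ^ i) * det (mat n n (\<lambda>(i, j). B i j))"
    using det_triangular_combination[OF expand, of n "\<lambda>i. 3 ^ i" "\<lambda>i. of_nat"] F by simp
  also have "det (mat n n (\<lambda>(i, j). B i j))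
    = det (mat n n (\<lambda>(i, j). 1 * (poly (F ?y i) (?y j) / fact (2 * j + 1))))"
    using det_triangular_combination[OF expand, of n "\<lambda>_. 1" "\<lambda>i. ?y"] F by simp
  also have "\<dots> = (\<Prod>i<n. 2 ^ i * fact i / fact (2 * i + 1))"
  proof -
    have "poly (F ?y i) (?y j) = 0" if "j < i" for i j
      using that by (auto simp: F_def poly_prod)
    moreover have "poly (F ?y i) (?y i) = 2 ^ i * fact i" for i
    proof -
      have "poly (F ?y i) (?y i) = (\<Prod>l<i. 2 * of_nat (i - l))"
        by (auto simp: F_def poly_prod of_nat_diff algebra_simps intro!: prod.cong)
      also have "\<dots> = 2 ^ i * of_nat (\<Prod>l<i. i - l)"
        by (simp only: prod.distrib of_nat_prod prod_constant card_lessThan)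
      also have "\<dots> = 2 ^ i * fact i"
        by (simp only: fact_prod_rev atLeast0LessThan)
      finally show ?thesis .
    qed
    ultimately show ?thesis
      by (subst det_upper_triangular[of _ n])
        (auto simp: prod_list_diag_prod atLeast0LessThan simp del: fact_Suc intro!: prod.cong)
  qed
  finally show ?thesis
    by (simp add: power_mult_distrib[symmetric] mult.assoc[symmetric] del: fact_Suc flip: prod.distrib)
qed

subsection \<open>Power series\<close>

text \<open>The series (1 - t)^(- x - 1), given by its coefficients because the exponent is an
  arbitrary field element.\<close>

definition neg_binomial_fps :: "'a :: field_char_0 \<Rightarrow> 'a fps" where
  "neg_binomial_fps x = Abs_fps (\<lambda>l. pochhammer (x + 1) l / fact l)"

lemma neg_binomial_fps_nth: "neg_binomial_fps x $ m = (x + of_nat m) gchoose m"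
  by (simp add: neg_binomial_fps_def gbinomial_pochhammer')

lemma neg_binomial_fps_mult: "neg_binomial_fps x * (1 - fps_X) = neg_binomial_fps (x - 1)"
proof (rule fps_ext)
  fix m
  show "(neg_binomial_fps x * (1 - fps_X)) $ m = neg_binomial_fps (x - 1) $ m"
  proof (cases m)
    case (Suc l)
    have "pochhammer x (Suc l) = x * pochhammer (x + 1) l"
      by (simp add: pochhammer_rec)
    moreover have "pochhammer (x + 1) (Suc l) = (x + 1 + of_nat l) * pochhammer (x + 1) l"
      by (simp add: pochhammer_rec')
    ultimately show ?thesis using Suc
      by (simp add: neg_binomial_fps_def ring_distribs divide_simps del: pochhammer_Suc of_nat_Suc)
        (simp add: algebra_simps)
  qed (simp add: neg_binomial_fps_def)
qed

abbreviation geometric_fps :: "'a :: field_char_0 fps" where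
  "geometric_fps \<equiv> inverse (1 - fps_X)"

lemma geometric_fps_mult: "(1 - fps_X) * geometric_fps = (1 :: 'a :: field_char_0 fps)"
  by (rule inverse_mult_eq_1') simp

lemma neg_binomial_fps_mult_power:
  "neg_binomial_fps x * (1 - fps_X) ^ i = neg_binomial_fps (x - of_nat i)"
proof (induction i)
  case (Suc i)
  then show ?case
    using neg_binomial_fps_mult[of "x - of_nat i"] by (simp add: algebra_simps)
qed simp

lemma neg_binomial_fps_mult_geometric_power:
  "neg_binomial_fps x * geometric_fps ^ i = neg_binomial_fps (x + of_nat i)"
proof -
  have "neg_binomial_fps x = neg_binomial_fps (x + of_nat i) * (1 - fps_X) ^ i"
    by (simp add: neg_binomial_fps_mult_power)
  then show ?thesis
    by (simp add: mult.assoc geometric_fps_mult flip: power_mult_distrib)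
qed

text \<open>The anchor is x = -1, where every Pochhammer symbol of positive length contains the
  factor 0.\<close>

lemma neg_binomial_fps_negative: "neg_binomial_fps (- 1 - of_nat c :: 'a :: field_char_0) = (1 - fps_X) ^ c"
proof -
  have "neg_binomial_fps (- 1 :: 'a) = 1"
    by (rule fps_ext) (simp add: neg_binomial_fps_def pochhammer_0_left)
  then show ?thesis using neg_binomial_fps_mult_power[of "- 1 :: 'a" c] by simp
qed

text \<open>The coefficient of \<open>t ^ m\<close> in \<open>q(t) (1 - t) ^ (- X - 1)\<close>, as a polynomial in \<open>X\<close>.\<close>

definition coeff_poly :: "'a :: field_char_0 fps \<Rightarrow> nat \<Rightarrow> 'a poly" where
  "coeff_poly q m = (\<Sum>l\<le>m. smult (q $ (m - l) / fact l) (pochhammer [:1, 1:] l))"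

lemma poly_coeff_poly: "poly (coeff_poly q m) x = (neg_binomial_fps x * q) $ m"
proof -
  have "poly (pochhammer [:1, 1:] l) x = pochhammer (x + 1) l" for l
    by (induction l) (simp_all add: pochhammer_Suc algebra_simps)
  then show ?thesis
    by (simp add: coeff_poly_def poly_sum fps_mult_nth neg_binomial_fps_def atLeast0AtMost)
      (simp add: mult_ac)
qed

text \<open>The polynomials are compared by their values, which suffices over an infinite
  field.\<close>

lemma coeff_poly_linear:
  "coeff_poly (\<Sum>k\<in>K. fps_const (c k) * q k) m = (\<Sum>k\<in>K. [:c k:] * coeff_poly (q k) m)"
proof (rule poly_eq_poly_eq_iff[THEN iffD1], rule ext)
  fix x
  have "neg_binomial_fps x * (\<Sum>k\<in>K. fps_const (c k) * q k)
    = (\<Sum>k\<in>K. fps_const (c k) * (neg_binomial_fps x * q k))"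
    by (simp add: sum_distrib_left mult_ac)
  then show "poly (coeff_poly (\<Sum>k\<in>K. fps_const (c k) * q k) m) x
    = poly (\<Sum>k\<in>K. [:c k:] * coeff_poly (q k) m) x"
    by (simp add: poly_coeff_poly poly_sum fps_sum_nth)
qed

text \<open>The summand of index l has degree at most l and a factor \<open>q $ (m - l)\<close>,
  which is 0 for l > m - i. Multiplying by X^i covers the case i > m too, where
  \<open>coeff_poly q m\<close> is 0.\<close>

lemma coeff_poly_subdegree:
  assumes "\<And>k. k < i \<Longrightarrow> q $ k = 0"
  shows "degree (monom 1 i * coeff_poly q m) \<le> m"
    and "coeff (monom 1 i * coeff_poly q m) m = (if i \<le> m then q $ i / fact (m - i) else 0)"
proof -
  have P: "degree (pochhammer [:1, 1:] l :: 'a poly) = l \<and> coeff (pochhammer [:1, 1:] l :: 'a poly) l = 1" for l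
  proof (induction l)
    case (Suc l)
    have [simp]: "[:1, 1:] + of_nat l = [:1 + of_nat l, 1 :: 'a:]"
      by (simp add: of_nat_poly)
    have "pochhammer [:1, 1:] l \<noteq> (0 :: 'a poly)" using Suc by auto
    then show ?case using Suc
      by (simp add: pochhammer_Suc degree_mult_eq del: mult_pCons_right)
        (use coeff_mult_degree_sum[of "pochhammer [:1, 1:] l" "[:1 + of_nat l, 1 :: 'a:]"] in \<open>simp add: coeff_eq_0\<close>)
  qed auto
  have "degree (monom 1 i * smult (q $ (m - l) / fact l) (pochhammer [:1, 1:] l)) \<le> m" if "l \<le> m" for l
  proof (cases "m - l < i")
    case False
    then show ?thesis
      using P[of l] degree_mult_le[of "monom 1 i" "smult (q $ (m - l) / fact l) (pochhammer [:1, 1:] l)"]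
        degree_smult_le[of "q $ (m - l) / fact l" "pochhammer [:1, 1:] l"] that
      by (simp add: degree_monom_eq)
  qed (simp add: assms)
  then show "degree (monom 1 i * coeff_poly q m) \<le> m"
    unfolding coeff_poly_def sum_distrib_left by (intro degree_sum_le) auto
  have "coeff (coeff_poly q m) (m - i) = q $ i / fact (m - i)" if "i \<le> m"
  proof -
    have "coeff (coeff_poly q m) (m - i)
      = (\<Sum>l\<le>m. q $ (m - l) / fact l * coeff (pochhammer [:1, 1:] l) (m - i))"
      by (simp add: coeff_poly_def coeff_sum)
    also have "\<dots> = (\<Sum>l\<in>{m - i}. q $ (m - l) / fact l * coeff (pochhammer [:1, 1:] l) (m - i))"
    proof (rule sum.mono_neutral_right)
      show "\<forall>l\<in>{..m} - {m - i}. q $ (m - l) / fact l * coeff (pochhammer [:1, 1:] l) (m - i) = 0"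
      proof
        fix l assume "l \<in> {..m} - {m - i}"
        then consider "m - l < i" | "l < m - i" using \<open>i \<le> m\<close> by fastforce
        then show "q $ (m - l) / fact l * coeff (pochhammer [:1, 1:] l) (m - i) = 0"
          by cases (use P[of l] in \<open>simp_all add: assms coeff_eq_0\<close>)
      qed
    qed auto
    finally show ?thesis using P[of "m - i"] that by simp
  qed
  then show "coeff (monom 1 i * coeff_poly q m) m = (if i \<le> m then q $ i / fact (m - i) else 0)"
    by (simp add: coeff_monom_mult)
qed

subsection \<open>Row operations\<close>

text \<open>The series u = \<alpha> + \<beta> with t = \<open>fps_X\<close>.\<close>

definition row_fps :: "'a :: field_char_0 fps" where
  "row_fps = (1 - fps_X) + 4 * geometric_fps"

abbreviation fps_of_row_poly :: "'a :: field_char_0 poly \<Rightarrow> 'a fps" where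
  "fps_of_row_poly p \<equiv> poly (map_poly fps_const p) row_fps"

text \<open>Rows are given by polynomials in u, so that row operations become changes of the family
  \<open>P\<close>.\<close>

definition row_det :: "nat \<Rightarrow> (nat \<Rightarrow> 'a :: field_char_0 poly) \<Rightarrow> 'a poly" where
  "row_det n P = det (mat n n (\<lambda>(i, j). coeff_poly (fps_of_row_poly (P i)) (2 * j + 1)))"

interpretation fps_const_hom: comm_ring_hom fps_const
  by unfold_locales auto

interpretation map_poly_fps_const_hom: map_poly_comm_ring_hom fps_const ..

text \<open>Expanding \<open>P i\<close> in powers of its variable is a triangular row
  operation.\<close>

lemma row_det_eq:
  fixes P :: "nat \<Rightarrow> 'a :: field_char_0 poly"
  assumes "\<And>i. i < n \<Longrightarrow> degree (P i) \<le> i"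
  shows "row_det n P = (\<Prod>i<n. [:coeff (P i) i:]) * row_det n (\<lambda>i. monom 1 i)"
proof -
  have "coeff_poly (fps_of_row_poly (P i)) m = (\<Sum>k\<le>i. [:coeff (P i) k:] * coeff_poly (row_fps ^ k) m)"
    if "i < n" for i m
  proof -
    have "fps_of_row_poly (P i) = (\<Sum>k\<le>degree (P i). fps_const (coeff (P i) k) * row_fps ^ k)"
      by (simp add: poly_altdef degree_map_poly coeff_map_poly)
    also have "\<dots> = (\<Sum>k\<le>i. fps_const (coeff (P i) k) * row_fps ^ k)"
      using assms[OF that] by (intro sum.mono_neutral_left) (auto simp: coeff_eq_0)
    finally show ?thesis by (simp only: coeff_poly_linear)
  qed
  moreover have "fps_of_row_poly (monom (1 :: 'a) i) = row_fps ^ i" for i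
    by (simp add: poly_monom map_poly_monom)
  ultimately show ?thesis
    using det_triangular_combination[of n "\<lambda>i j. coeff_poly (fps_of_row_poly (P i)) (2 * j + 1)"
        "\<lambda>i k. [:coeff (P i) k:]" "\<lambda>k j. coeff_poly (row_fps ^ k) (2 * j + 1)"]
    unfolding row_det_def by (simp only:)
qed

text \<open>All monic families share one determinant, so a different one may be chosen for each root
  and for the degree bound.\<close>

lemma row_det_monic:
  assumes "\<And>i. i < n \<Longrightarrow> degree (P i) = i" "\<And>i. i < n \<Longrightarrow> lead_coeff (P i) = 1"
  shows "row_det n P = row_det n (\<lambda>i. monom 1 i)"
  using assms row_det_eq[of n P] by (simp flip: one_pCons)

lemma row_fps_identities:
  defines "g \<equiv> geometric_fps :: 'a :: field_char_0 fps"
  shows "row_fps - 4 = (1 + fps_X)\<^sup>2 * g" "row_fps - 2 = (3 + fps_X\<^sup>2) * g"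
    "row_fps - 5 = fps_X * ((3 + fps_X) * g)"
proof -
  have g: "(1 - fps_X) * g = 1" unfolding g_def by (rule geometric_fps_mult)
  define y :: "'a fps" where "y = fps_X"
  \<comment> \<open>Repeated use of t g = g - 1 reduces all three identities to linear expressions
    in 1, t and g.\<close>
  have yg: "y * g = g - 1" using g by (simp add: y_def algebra_simps)
  then have yyg: "y * (y * g) = g - 1 - y" by (simp only: yg right_diff_distrib mult_1_right)
  have expand: "(1 + y)\<^sup>2 * g = g + 2 * (y * g) + y * (y * g)" "(3 + y\<^sup>2) * g = 3 * g + y * (y * g)"
    "y * ((3 + y) * g) = 3 * (y * g) + y * (y * g)"
    by (simp_all add: power2_eq_square algebra_simps)
  have row: "row_fps = 1 - y + 4 * g" by (simp add: row_fps_def g_def y_def)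
  show "row_fps - 4 = (1 + fps_X)\<^sup>2 * g" "row_fps - 2 = (3 + fps_X\<^sup>2) * g"
    "row_fps - 5 = fps_X * ((3 + fps_X) * g)"
    unfolding row y_def[symmetric] expand unfolding yyg unfolding yg by simp_all
qed

section \<open>Vanishing of rows at negative integers\<close>

lemma fps_of_row_poly_linear:
  "fps_of_row_poly [:- numeral a, 1:] = row_fps - numeral a"
  by (simp add: map_poly_pCons numeral_fps_const flip: fps_const_neg)

lemma fps_odd_nth_power_mult_eq_0:
  fixes p q :: "'a :: comm_ring_1 fps"
  assumes "\<And>k. odd k \<Longrightarrow> p $ k = 0" "\<And>k. odd k \<Longrightarrow> q $ k = 0" "odd k"
  shows "(p ^ a * q ^ b) $ k = 0"
proof -
  have mult: "(f * h) $ k = 0"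
    if "\<And>k. odd k \<Longrightarrow> f $ k = 0" "\<And>k. odd k \<Longrightarrow> h $ k = 0" "odd k" for f h :: "'a fps" and k
  proof -
    have "f $ i * h $ (k - i) = 0" if "i \<le> k" for i
      using that \<open>odd k\<close> \<open>\<And>k. odd k \<Longrightarrow> f $ k = 0\<close>[of i] \<open>\<And>k. odd k \<Longrightarrow> h $ k = 0\<close>[of "k - i"]
      by (cases "odd i") auto
    then show ?thesis by (simp add: fps_mult_nth)
  qed
  have "(f ^ a) $ k = 0" if "\<And>k. odd k \<Longrightarrow> f $ k = 0" "odd k" for f :: "'a fps" and a k
    using that(2) by (induction a arbitrary: k) (auto intro: mult that(1) odd_pos)
  then show ?thesis using assms by (intro mult) auto
qed

text \<open>At \<open>X = - (1 + d + 3 m)\<close>, the row of \<open>(Y - 4) ^ m (Y - 2) ^ d\<close> consists of the odd coefficients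
  of the even series \<open>(1 - t\<^sup>2) ^ (2 m) (3 + t\<^sup>2) ^ d\<close>.\<close>

lemma linear_dvd_coeff_poly:
  assumes "odd k"
  shows "[:of_nat (1 + d + 3 * m), 1:] dvd
    coeff_poly (fps_of_row_poly ([:- 4, 1:] ^ m * [:- 2, 1:] ^ d)) k"
proof -
  let ?g = "geometric_fps :: 'a fps"
  have regroup: "y ^ (d + 3 * m) * ((z\<^sup>2 * g) ^ m * (w * g) ^ d) = (y * g) ^ (d + m) * ((y * z)\<^sup>2) ^ m * w ^ d"
    for y z g w :: "'a fps"
  proof -
    \<comment> \<open>Of the d + 3 m factors 1 - t, d + m cancel the denominators and the remaining
      2 m pair with (1 + t)^(2 m).\<close>
    have "d + 3 * m = d + m + 2 * m" by simp
    then have "y ^ (d + 3 * m) = y ^ d * y ^ m * (y\<^sup>2) ^ m"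
      by (simp only: power_add power_mult)
    then show ?thesis by (simp only: power_mult_distrib power_add mult_ac)
  qed
  have "(1 - fps_X) ^ (d + 3 * m) * (((1 + fps_X)\<^sup>2 * ?g) ^ m * ((3 + fps_X\<^sup>2) * ?g) ^ d)
    = ((1 - fps_X) * ?g) ^ (d + m) * (((1 - fps_X) * (1 + fps_X))\<^sup>2) ^ m * (3 + fps_X\<^sup>2) ^ d"
    by (rule regroup)
  also have "\<dots> = ((1 - fps_X\<^sup>2)\<^sup>2) ^ m * (3 + fps_X\<^sup>2) ^ d"
  proof -
    have "(1 - fps_X) * (1 + fps_X) = (1 - fps_X\<^sup>2 :: 'a fps)"
      by (simp add: algebra_simps power2_eq_square)
    then show ?thesis by (simp only: geometric_fps_mult power_one mult_1_left)
  qed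
  finally have "poly (coeff_poly (fps_of_row_poly ([:- 4, 1:] ^ m * [:- 2, 1:] ^ d)) k)
      (- 1 - of_nat (d + 3 * m))
    = (((1 - fps_X\<^sup>2)\<^sup>2) ^ m * (3 + fps_X\<^sup>2) ^ d :: 'a fps) $ k"
    using row_fps_identities(1,2)[where ?'a = 'a]
    by (simp only: poly_coeff_poly neg_binomial_fps_negative map_poly_fps_const_hom.hom_mult
      map_poly_fps_const_hom.hom_power poly_mult poly_power fps_of_row_poly_linear)
  also have "\<dots> = 0"
  proof -
    have even: "(1 - fps_X\<^sup>2 :: 'a fps) $ k = 0" "(3 + fps_X\<^sup>2 :: 'a fps) $ k = 0" if "odd k" for k
      using that by (auto simp: fps_X_power_iff numeral_fps_const odd_pos)
    have "((1 - fps_X\<^sup>2) ^ (2 * m) * (3 + fps_X\<^sup>2) ^ d :: 'a fps) $ k = 0"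
      by (intro fps_odd_nth_power_mult_eq_0 even assms)
    then show ?thesis by (simp only: power_mult)
  qed
  finally have "poly (coeff_poly (fps_of_row_poly ([:- 4, 1:] ^ m * [:- 2, 1 :: 'a:] ^ d)) k)
      (- 1 - of_nat (d + 3 * m)) = 0" .
  moreover have "- 1 - of_nat (d + 3 * m) = - (of_nat (1 + d + 3 * m) :: 'a)" by simp
  ultimately show ?thesis
    by (simp only: dvd_iff_poly_eq_0)
qed

text \<open>The product of linear factors divides the determinant and already has the largest
  possible degree, so the quotient is a constant, read off from the top coefficient.\<close>

lemma row_det_eq_monom:
  "row_det n (\<lambda>i. monom 1 i)
    = smult (\<Prod>i<n. 6 ^ i * fact i / fact (2 * i + 1))
        (\<Prod>e<n. \<Prod>m\<le>e. [:of_nat (1 + e + 2 * m), 1 :: 'a :: field_char_0:])"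
proof -
  let ?D = "row_det n (\<lambda>i. monom 1 i) :: 'a poly"
  let ?T = "Sigma {..<n} (\<lambda>e. {..e})"
  \<comment> \<open>In row \<open>e\<close>, the exponent \<open>m\<close> of Y - 4 leaves d = e - m
    for Y - 2, so 3 m + d becomes \<open>e + 2 * m\<close>.\<close>
  let ?h = "\<lambda>(e, m). e + 2 * m"
  define N where "N = (\<Sum>e<n. Suc e)"
  define Q where "Q = (\<Prod>e<n. \<Prod>m\<le>e. [:of_nat (1 + e + 2 * m), 1 :: 'a:])"
  have Q: "Q = (\<Prod>z\<in>?T. [:of_nat (1 + ?h z), 1 :: 'a:])"
    unfolding Q_def by (subst prod.Sigma) (auto simp: case_prod_beta)
  have "[:b, 1:] ^ card {z \<in> ?T. of_nat (1 + ?h z) = b} dvd ?D" for b :: 'a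
  proof (cases "\<exists>c. b = of_nat (1 + c)")
    case True
    then obtain c where c: "b = of_nat (1 + c)" by blast
    \<comment> \<open>Rows \<open>e\<close> that admit a suitable \<open>m\<close>, which is then (c
      - e) / 2, get the polynomial that vanishes there; the others keep monomials, so the family
      stays monic.\<close>
    define R where "R e = (if \<exists>m\<le>e. e + 2 * m = c then [:- 4, 1 :: 'a:] ^ ((c - e) div 2)
      * [:- 2, 1:] ^ (e - (c - e) div 2) else monom 1 e)" for e
    have "lead_coeff ([:- 4, 1 :: 'a:] ^ i * [:- 2, 1:] ^ k) = 1" for i k
      by (subst lead_coeff_mult, subst lead_coeff_power, subst lead_coeff_power) simp
    then have R: "degree (R e) = e" "lead_coeff (R e) = 1" for e
      by (auto simp only: R_def) (auto simp: degree_mult_eq degree_power_eq degree_monom_eq)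
    \<comment> \<open>As \<open>e\<close> and \<open>c\<close> determine \<open>m\<close>, there are
      as many such rows as factors equal to \<open>[:b, 1:]\<close> in \<open>Q\<close>.\<close>
    let ?S = "fst ` {z \<in> ?T. ?h z = c}"
    have "of_nat (1 + l) = b \<longleftrightarrow> l = c" for l unfolding c by (metis add_left_cancel of_nat_eq_iff)
    then have "{z \<in> ?T. of_nat (1 + ?h z) = b} = {z \<in> ?T. ?h z = c}" by (simp only:)
    moreover have "card {z \<in> ?T. ?h z = c} = card ?S"
      by (rule card_image[symmetric]) (auto simp: inj_on_def)
    moreover have "[:b, 1:] ^ card ?S dvd row_det n R"
      unfolding row_det_def
    proof (rule power_card_dvd_det)
      fix e j assume "e \<in> ?S"
      then obtain m where m: "m \<le> e" "e + 2 * m = c" by auto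
      then have "R e = [:- 4, 1:] ^ m * [:- 2, 1:] ^ (e - m)"
        by (auto simp: R_def)
      moreover have "1 + c = 1 + (e - m) + 3 * m" using m by simp
      then have "b = of_nat (1 + (e - m) + 3 * m)" by (simp only: c)
      ultimately show "[:b, 1:] dvd coeff_poly (fps_of_row_poly (R e)) (2 * j + 1)"
        using linear_dvd_coeff_poly[of "2 * j + 1" "e - m" m, where ?'a = 'a] by (simp only:) simp
    qed auto
    moreover have "row_det n R = ?D" using R by (intro row_det_monic) auto
    ultimately show ?thesis by (simp only:)
  next
    case False
    then have "of_nat (1 + l) \<noteq> b" for l by blast
    then have "{z \<in> ?T. of_nat (1 + ?h z) = b} = {}" by (simp only:) simp
    then show ?thesis by (simp only: card.empty power_0 one_dvd)
  qed
  then have "Q dvd ?D" unfolding Q by (intro prod_linear_dvd) auto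
  then obtain s where s: "?D = Q * s" by (auto simp: dvd_def)
  have Q_deg: "degree Q = N" and Q_lead: "coeff Q N = 1"
  proof -
    have "card ?T = N" by (simp add: N_def)
    then show "coeff Q N = 1" and "degree Q = N"
      using prod_degree_le_coeff[of ?T "\<lambda>z. [:of_nat (1 + ?h z), 1 :: 'a:]" "\<lambda>_. 1"]
        le_degree[of Q N] unfolding Q by (simp_all add: case_prod_beta)
  qed
  have D_deg: "degree ?D \<le> N" and D_lead: "coeff ?D N = (\<Prod>i<n. 6 ^ i * fact i / fact (2 * i + 1))"
  proof -
    let ?P = "\<lambda>i. [:- 5, 1 :: 'a:] ^ i"
    let ?A = "\<lambda>i j. coeff_poly (fps_of_row_poly (?P i)) (2 * j + 1)"
    let ?g = "geometric_fps :: 'a fps"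
    have D: "?D = det (mat n n (\<lambda>(i, j). ?A i j))"
    proof -
      have "degree (?P i) = i" "lead_coeff (?P i) = 1" for i
        by (simp add: degree_power_eq) (subst lead_coeff_power, simp)
      then have "row_det n ?P = ?D" by (rule row_det_monic)
      then show ?thesis by (simp only: row_det_def)
    qed
    have P: "fps_of_row_poly (?P i) = fps_X ^ i * ((3 + fps_X) * ?g) ^ i" for i
      using row_fps_identities(3)[where ?'a = 'a]
      by (simp only: map_poly_fps_const_hom.hom_power poly_power fps_of_row_poly_linear
        power_mult_distrib)
    \<comment> \<open>The series u - 5 starts with 3 t, so row i starts with 3^i t^i.\<close>
    have nth: "fps_of_row_poly (?P i) $ k = (if k < i then 0 else 3 ^ i)" if "k \<le> i" for i k
      using that unfolding P by (simp add: fps_X_power_mult_nth fps_nth_power_0 numeral_fps_const)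
    \<comment> \<open>Column bounds minus row shifts: n^2 - n (n - 1) / 2 = n (n + 1) / 2.\<close>
    have N: "N + (\<Sum>i<n. i) = (\<Sum>j<n. 2 * j + 1)"
      by (simp add: N_def flip: sum.distrib) (intro sum.cong; simp)
    have deg: "degree (monom 1 i * ?A i j) \<le> 2 * j + 1"
      and lead: "coeff (monom 1 i * ?A i j) (2 * j + 1)
        = (if i \<le> 2 * j + 1 then 3 ^ i / fact (2 * j + 1 - i) else 0)" for i j
      using nth[of _ i] coeff_poly_subdegree[of i "fps_of_row_poly (?P i)" "2 * j + 1"] by simp_all
    show "degree ?D \<le> N" unfolding D by (rule det_degree_le_coeff(1)[OF deg N])
    show "coeff ?D N = (\<Prod>i<n. 6 ^ i * fact i / fact (2 * i + 1))"
      unfolding D by (simp only: det_degree_le_coeff(2)[OF deg N] lead det_falling_factorial_odd)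
  qed
  have "degree s = 0"
  proof (cases "s = 0")
    case False
    moreover have "Q \<noteq> 0" using Q_lead by auto
    ultimately show ?thesis using D_deg Q_deg unfolding s by (simp add: degree_mult_eq)
  qed simp
  then obtain a where "s = [:a:]" by (rule degree_eq_zeroE)
  then have a: "?D = smult a Q" using s by (simp add: mult.commute)
  then have "a = (\<Prod>i<n. 6 ^ i * fact i / fact (2 * i + 1))"
    using D_lead Q_lead by simp
  then show ?thesis using a by (simp only: Q_def)
qed

text \<open>Dickson polynomials: \<open>\<alpha> ^ i + \<beta> ^ i\<close> in terms of \<open>\<alpha> + \<beta>\<close> when \<open>\<alpha> \<beta> = 4\<close>.\<close>

fun dickson_poly :: "nat \<Rightarrow> 'a :: field_char_0 poly" where
  "dickson_poly 0 = [:2:]"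
| "dickson_poly (Suc 0) = [:0, 1:]"
| "dickson_poly (Suc (Suc i)) = pCons 0 (dickson_poly (Suc i)) - smult 4 (dickson_poly i)"

lemma dickson_poly_monic:
  "degree (dickson_poly i :: 'a :: field_char_0 poly) \<le> i"
  "coeff (dickson_poly i :: 'a poly) i = (if i = 0 then 2 else 1)"
proof -
  have "degree (dickson_poly i :: 'a poly) \<le> i \<and> coeff (dickson_poly i :: 'a poly) i = (if i = 0 then 2 else 1)"
  proof (induction i rule: dickson_poly.induct)
    case (3 i)
    have "degree (smult 4 (dickson_poly i) :: 'a poly) \<le> i"
      using 3(2) degree_smult_le[of 4 "dickson_poly i :: 'a poly"] by linarith
    moreover have "degree (pCons 0 (dickson_poly (Suc i)) :: 'a poly) \<le> Suc (Suc i)"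
      using 3(1) degree_pCons_le[of 0 "dickson_poly (Suc i) :: 'a poly"] by linarith
    ultimately show ?case
      using 3(1) by (auto intro!: degree_diff_le simp del: degree_smult_eq simp: coeff_eq_0)
  qed auto
  then show "degree (dickson_poly i :: 'a poly) \<le> i"
    "coeff (dickson_poly i :: 'a poly) i = (if i = 0 then 2 else 1)" by auto
qed

text \<open>Since \<alpha> and \<beta> are the roots of z^2 - u z + 4, their power sums satisfy the
  recurrence of the Dickson polynomials.\<close>

lemma fps_of_dickson_poly:
  "fps_of_row_poly (dickson_poly i) = (4 * geometric_fps) ^ i + (1 - fps_X) ^ i"
proof (induction i rule: dickson_poly.induct)
  case (3 i)
  have *: "(a + b) * (b ^ Suc i + a ^ Suc i) - 4 * (b ^ i + a ^ i) = b ^ Suc (Suc i) + a ^ Suc (Suc i)"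
    if "a * b = 4" for a b :: "'a fps"
  proof -
    have "(a + b) * (b ^ Suc i + a ^ Suc i) = b ^ Suc (Suc i) + a ^ Suc (Suc i) + (a * b) * (b ^ i + a ^ i)"
      by (simp add: algebra_simps)
    then show ?thesis using that by simp
  qed
  have "(1 - fps_X) * (4 * geometric_fps) = (4 :: 'a fps)"
    using geometric_fps_mult[where ?'a = 'a] by (simp add: mult.left_commute)
  note step = *[OF this]
  have pCons: "fps_of_row_poly (pCons 0 p) = row_fps * fps_of_row_poly p" for p :: "'a poly"
    by (cases "p = 0") simp_all
  have smult: "fps_of_row_poly (smult 4 p) = 4 * fps_of_row_poly p" for p :: "'a poly"
    using map_poly_fps_const_hom.hom_mult[of "[:4:]" p]
    by (simp add: map_poly_pCons numeral_fps_const)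
  show ?case
    by (simp only: dickson_poly.simps map_poly_fps_const_hom.hom_minus poly_diff pCons smult 3)
      (simp only: row_fps_def step)
qed (simp_all add: map_poly_pCons row_fps_def numeral_fps_const)

text \<open>Multiplying (1 - t)^(- x - 1) by \<beta>^i or \<alpha>^i shifts x up or down by i, with
  a factor 4^i in the first case. Hence the entries are the values at x of the Dickson rows.\<close>

lemma det_eq_prod:
  fixes x :: "'a :: field_char_0"
  assumes "n \<ge> 1"
  shows "det (mat n n (\<lambda>(i, j).
        4 ^ i * ((x + of_nat i + 2 * of_nat j + 1) gchoose (2 * j + 1))
        + ((x - of_nat i + 2 * of_nat j + 1) gchoose (2 * j + 1))))
    = 2 * (\<Prod>i<n. 6 ^ i * fact i / fact (2 * i + 1)) * (\<Prod>e<n. \<Prod>m\<le>e. x + of_nat (1 + e + 2 * m))"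
proof -
  have eval_hom: "comm_ring_hom (\<lambda>p. poly p x)" by unfold_locales auto
  have entry: "4 ^ i * ((x + of_nat i + 2 * of_nat j + 1) gchoose (2 * j + 1))
        + ((x - of_nat i + 2 * of_nat j + 1) gchoose (2 * j + 1))
      = poly (coeff_poly (fps_of_row_poly (dickson_poly i)) (2 * j + 1)) x" for i j
  proof -
    have "neg_binomial_fps x * ((4 * geometric_fps) ^ i + (1 - fps_X) ^ i)
      = fps_const (4 ^ i) * neg_binomial_fps (x + of_nat i) + neg_binomial_fps (x - of_nat i)"
      by (simp add: ring_distribs power_mult_distrib mult.left_commute neg_binomial_fps_mult_power
        neg_binomial_fps_mult_geometric_power numeral_fps_const fps_const_power)
    then show ?thesis
      by (simp add: poly_coeff_poly fps_of_dickson_poly neg_binomial_fps_nth add_ac)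
  qed
  have "det (mat n n (\<lambda>(i, j).
        4 ^ i * ((x + of_nat i + 2 * of_nat j + 1) gchoose (2 * j + 1))
        + ((x - of_nat i + 2 * of_nat j + 1) gchoose (2 * j + 1)))) = poly (row_det n dickson_poly) x"
    unfolding row_det_def entry
    by (subst comm_ring_hom.hom_det[OF eval_hom, symmetric]) (auto intro!: arg_cong[of _ _ det])
  also have "row_det n dickson_poly = [:2 :: 'a:] * row_det n (\<lambda>i. monom 1 i)"
  proof -
    \<comment> \<open>As n is positive, row 0 is present; its coefficient 2 is the factor 2 in front
      of the product.\<close>
    obtain k where n: "n = Suc k" using assms by (cases n) auto
    have "(\<Prod>i<n. [:coeff (dickson_poly i :: 'a poly) i:]) = [:2:]"
      by (simp only: n prod.lessThan_Suc_shift dickson_poly_monic) (simp flip: one_pCons)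
    then show ?thesis by (simp add: row_det_eq dickson_poly_monic)
  qed
  finally show ?thesis
    by (simp only: row_det_eq_monom poly_mult poly_smult poly_prod poly_pCons poly_0
      mult_zero_right mult_1_right add_0_right) (simp only: mult.assoc add.commute[of _ x])
qed

subsection \<open>The product formulas\<close>

text \<open>Passing from n to n + 1 appends to the Pochhammer symbol of index i the factor x + 3 i +
  1 + (n - i) = x + 1 + n + 2 i; these are the new factors for \<open>e = n\<close>.\<close>

lemma prod_pochhammer:
  fixes x :: "'a :: field_char_0"
  shows "(\<Prod>i<n. pochhammer (x + 3 * of_nat i + 1) (n - i)) = (\<Prod>e<n. \<Prod>m\<le>e. x + of_nat (1 + e + 2 * m))"
proof (induction n)
  case (Suc n)
  have "(\<Prod>i<Suc n. pochhammer (x + 3 * of_nat i + 1) (Suc n - i))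
    = (\<Prod>i\<le>n. pochhammer (x + 3 * of_nat i + 1) (n - i) * (x + of_nat (1 + n + 2 * i)))"
    unfolding lessThan_Suc_atMost
    by (intro prod.cong refl) (simp add: Suc_diff_le pochhammer_Suc of_nat_diff algebra_simps)
  also have "\<dots> = (\<Prod>i<n. pochhammer (x + 3 * of_nat i + 1) (n - i)) * (\<Prod>i\<le>n. x + of_nat (1 + n + 2 * i))"
    by (simp add: prod.distrib flip: lessThan_Suc_atMost)
  finally show ?case by (simp only: Suc prod.lessThan_Suc)
qed simp

lemma prod_Gamma_quot:
  fixes x :: "'a :: field_char_0"
  shows "(\<Prod>i = 1..n. 2 ^ (2 * i - 1) * 3 ^ (i - 1)
         * Gamma_quot (of_nat i) (of_nat (2 * i))
         * Gamma_quot ((3 * of_nat i + x) / 2) ((of_nat i + x) / 2))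
    = (\<Prod>i<n. 6 ^ i * fact i / fact (2 * i + 1)) * (\<Prod>e<n. \<Prod>m\<le>e. x + of_nat (1 + e + 2 * m))"
proof -
  have factor: "2 ^ (2 * Suc i - 1) * 3 ^ (Suc i - 1)
         * Gamma_quot (of_nat (Suc i)) (of_nat (2 * Suc i))
         * Gamma_quot ((3 * of_nat (Suc i) + x) / 2) ((of_nat (Suc i) + x) / 2)
    = 6 ^ i * fact i / fact (2 * i + 1) * (\<Prod>m\<le>i. x + of_nat (1 + i + 2 * m))" for i
  proof -
    let ?k = "Suc i"
    have "Gamma_quot (of_nat ?k) (of_nat (2 * ?k)) = 1 / (pochhammer (of_nat ?k) ?k :: 'a)"
      by (simp only: mult_2 of_nat_add Gamma_quot_add')
    also have "pochhammer (of_nat ?k) ?k = (fact (2 * i + 1) / fact i :: 'a)"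
    proof -
      have "2 * i + 1 = i + ?k" by simp
      then have "fact i * pochhammer (of_nat ?k) ?k = (fact (2 * i + 1) :: 'a)"
        by (simp only: pochhammer_fact) (simp only: pochhammer_product'[of 1 i ?k] of_nat_Suc add.commute)
      then show ?thesis by (simp add: eq_divide_eq mult.commute del: fact_Suc of_nat_Suc)
    qed
    finally have g1: "Gamma_quot (of_nat ?k) (of_nat (2 * ?k)) = (fact i / fact (2 * i + 1) :: 'a)"
      by (simp only: divide_divide_eq_right mult_1_left)
    have "(3 * k + x) / 2 = (k + x) / 2 + k" for k
      by (simp add: field_simps)
    then have g2: "Gamma_quot ((3 * of_nat ?k + x) / 2) ((of_nat ?k + x) / 2) = pochhammer ((of_nat ?k + x) / 2) ?k"
      by (simp only: Gamma_quot_add)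
    \<comment> \<open>One 2 for each of the i + 1 factors clears the halves; the remaining i twos
      join 3^i to form 6^i.\<close>
    have g3: "2 ^ ?k * pochhammer ((of_nat ?k + x) / 2) ?k = (\<Prod>m\<le>i. x + of_nat (1 + i + 2 * m))"
    proof -
      have "2 ^ ?k * pochhammer ((of_nat ?k + x) / 2) ?k = (\<Prod>m\<le>i. 2 * ((of_nat ?k + x) / 2 + of_nat m))"
        by (simp only: pochhammer_prod prod.distrib prod_constant card_atMost atLeast0LessThan
          lessThan_Suc_atMost)
      also have "\<dots> = (\<Prod>m\<le>i. x + of_nat (1 + i + 2 * m))"
        by (intro prod.cong refl) (simp add: field_simps)
      finally show ?thesis .
    qed
    have "(2 :: 'a) ^ (2 * ?k - 1) * 3 ^ (?k - 1) = 6 ^ i * 2 ^ ?k"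
    proof -
      have "2 * ?k - 1 = i + ?k" by simp
      then have "(2 :: 'a) ^ (2 * ?k - 1) = 2 ^ i * 2 ^ ?k" by (simp only: power_add)
      moreover have "(6 :: 'a) ^ i = 2 ^ i * 3 ^ i" by (simp flip: power_mult_distrib)
      ultimately show ?thesis by simp
    qed
    then show ?thesis unfolding g1 g2 by (simp only: g3[symmetric]) (simp only: mult_ac times_divide_eq_left times_divide_eq_right)
  qed
  have "(\<Prod>i = 1..n. f i) = (\<Prod>i<n. f (Suc i))" for f :: "nat \<Rightarrow> 'a"
    by (rule prod.reindex_bij_witness[of _ Suc "\<lambda>i. i - 1"]) auto
  then show ?thesis by (simp only: factor) (simp only: prod.distrib)
qed

text \<open>In the quotient (n + 1)! / (2 n + 2)! the factor n + 1 cancels and a 2 remains in the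
  denominator, whence 2^(n + 1) beside 3^n in each step.\<close>

lemma prod_constants:
  "2 * (\<Prod>i<n. 6 ^ i * fact i / fact (2 * i + 1))
    = 2 ^ (((n + 1) choose 2) + 1) * 3 ^ (n choose 2) * (\<Prod>i = 1..n. fact i / fact (2 * i) :: 'a :: field_char_0)"
proof (induction n)
  case (Suc n)
  have key: "(6 :: 'a) ^ n * fact n / fact (2 * n + 1) = 2 ^ Suc n * 3 ^ n * (fact (Suc n) / fact (2 * Suc n))"
  proof -
    have "fact (2 * Suc n) = (2 * of_nat (Suc n)) * (fact (2 * n + 1) :: 'a)"
      by (simp add: algebra_simps)
    moreover have "fact (Suc n) = of_nat (Suc n) * (fact n :: 'a)" by (rule fact_Suc)
    moreover have "(6 :: 'a) ^ n = 2 ^ n * 3 ^ n" by (simp flip: power_mult_distrib)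
    ultimately show ?thesis by (simp del: fact_Suc of_nat_Suc)
  qed
  have choose: "((Suc n + 1) choose 2) + 1 = (((n + 1) choose 2) + 1) + Suc n" "Suc n choose 2 = (n choose 2) + n"
    by (simp_all add: numeral_2_eq_2)
  have "2 * (\<Prod>i<Suc n. 6 ^ i * fact i / fact (2 * i + 1))
    = 2 * (\<Prod>i<n. 6 ^ i * fact i / fact (2 * i + 1)) * ((6 :: 'a) ^ n * fact n / fact (2 * n + 1))"
    by (simp only: prod.lessThan_Suc mult.assoc)
  also have "\<dots> = (2 ^ (((n + 1) choose 2) + 1) * 2 ^ Suc n) * (3 ^ (n choose 2) * 3 ^ n)
      * ((\<Prod>i = 1..n. fact i / fact (2 * i)) * (fact (Suc n) / fact (2 * Suc n)))"
    by (simp only: Suc key) (simp only: mult_ac)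
  also have "\<dots> = 2 ^ (((Suc n + 1) choose 2) + 1) * 3 ^ (Suc n choose 2) * (\<Prod>i = 1..Suc n. fact i / fact (2 * i))"
    by (simp only: choose power_add) (simp del: fact_Suc)
  finally show ?case .
qed (simp add: numeral_2_eq_2)

theorem theorem15:
  fixes x :: "'a :: field_char_0 poly fract" and n :: nat
  assumes "x = to_fract [:0, 1:]" and "n \<ge> 1"
  shows
    "det (mat n n (\<lambda>(i, j).
        4 ^ i * ((x + of_nat i + 2 * of_nat j + 1) gchoose (2 * j + 1))
        + ((x - of_nat i + 2 * of_nat j + 1) gchoose (2 * j + 1))))
     = 2 * (\<Prod>i = 1..n.
         2 ^ (2 * i - 1) * 3 ^ (i - 1)
         * Gamma_quot (of_nat i) (of_nat (2 * i))
         * Gamma_quot ((3 * of_nat i + x) / 2) ((of_nat i + x) / 2))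
     \<and> 2 * (\<Prod>i = 1..n.
         2 ^ (2 * i - 1) * 3 ^ (i - 1)
         * Gamma_quot (of_nat i) (of_nat (2 * i))
         * Gamma_quot ((3 * of_nat i + x) / 2) ((of_nat i + x) / 2))
     = 2 ^ (((n + 1) choose 2) + 1) * 3 ^ (n choose 2)
       * (\<Prod>i = 1..n. fact i / fact (2 * i))
       * (\<Prod>i = 0..n - 1. pochhammer (x + 3 * of_nat i + 1) (n - i))"
proof -
  \<comment> \<open>This needs n >= 1: for n = 0 truncated subtraction would make the left side
    {0}.\<close>
  have "{0..n - 1} = {..<n}" using assms(2) by auto
  then have "2 * ((\<Prod>i<n. 6 ^ i * fact i / fact (2 * i + 1)) * (\<Prod>e<n. \<Prod>m\<le>e. x + of_nat (1 + e + 2 * m)))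
    = 2 ^ (((n + 1) choose 2) + 1) * 3 ^ (n choose 2) * (\<Prod>i = 1..n. fact i / fact (2 * i))
      * (\<Prod>i = 0..n - 1. pochhammer (x + 3 * of_nat i + 1) (n - i))"
    by (simp only: mult.assoc[symmetric] prod_constants prod_pochhammer)
  then show ?thesis
    unfolding det_eq_prod[OF assms(2)] prod_Gamma_quot by (simp only: mult.assoc simp_thms)
qed

end
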